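(* Let $\Phi$ be a TD system on $V$ of $q$-Racah type with diameter $d\ge1$ and associated nonzero scalars $q,a,b\in\mathbb{K}$, and let $K,B,\psi\in\mathrm{End}(V)$ be the associated linear transformations. Then $\psi$ is equal to each of the following: $$\frac{I-BK^{-1}}{q(aI-a^{-1}BK^{-1})},\qquad \frac{I-KB^{-1}}{q(a^{-1}I-aKB^{-1})},\qquad \frac{q(I-K^{-1}B)}{aI-a^{-1}K^{-1}B},\qquad \frac{q(I-B^{-1}K)}{a^{-1}I-aB^{-1}K},$$ where the denominators are invertible elements of $\mathrm{End}(V)$.
   Context: Let $\mathbb{K}$ be an algebraically closed field, $V$ a nonzero finite-dimensional $\mathbb{K}$-vector space, $\mathrm{End}(V)$ the algebra of linear maps $V\to V$, and $I$ the identity. For commuting $X,Y\in\mathrm{End}(V)$ with $Y$ invertible, $\frac{X}{Y}$ denotes $XY^{-1}=Y^{-1}X$. TD pairs and systems. A tridiagonal (TD) pair on $V$ is an ordered pair $A,A^*\in\mathrm{End}(V)$ such that: (i) each of $A,A^*$ is diagonalizable; (ii) there is an ordering $\{V_i\}_{i=0}^d$ of the eigenspaces of $A$ with $A^*V_i\subseteq V_{i-1}+V_i+V_{i+1}$ for $0\le i\le d$ ($V_{-1}=V_{d+1}=0$); (iii) there is an ordering $\{V_i^*\}_{i=0}^\delta$ of the eigenspaces of $A^*$ with $AV_i^*\subseteq V_{i-1}^*+V_i^*+V_{i+1}^*$ for $0\le i\le \delta$ ($V^*_{-1}=V^*_{\delta+1}=0$); (iv) there is no subspace $W$ with $AW\subseteq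 W$, $A^*W\subseteq W$, $W\ne0$, $W\neq V$. It is known that $d=\delta$ (the diameter); assume $d\ge1$. Orderings as in (ii), (iii) are called standard. The primitive idempotent for an eigenspace of a diagonalizable map is the projection onto it along the sum of the other eigenspaces; an ordering of the primitive idempotents is standard if the corresponding ordering of eigenspaces is. A TD system on $V$ is a sequence $\Phi=(A;\{E_i\}_{i=0}^d;A^*;\{E_i^*\}_{i=0}^d)$ where $A,A^*$ is a TD pair on $V$ and $\{E_i\}$ (resp. $\{E_i^*\}$) is a standard ordering of the primitive idempotents of $A$ (resp. $A^*$). Let $\theta_i$ (resp. $\theta_i^*$) be the eigenvalue of $A$ (resp. $A^*$) for $E_i$ (resp. $E_i^*$). $\Phi$ has $q$-Racah type, with scalars $q,a,b$, if $q,a,b\in\mathbb{K}$ are nonzero, $q^4\ne1$, and $\theta_i=aq^{d-2i}+a^{-1}q^{2i-d}$, $\theta_i^*=bq^{d-2i}+b^{-1}q^{2i-d}$ for $0\le i\le d$. Split decompositions. For $0\le i\le d$ let $U_i=(E_0^*V+\cdots+E_i^*V)\cap(E_iV+\cdots+E_dV)$ and $U_i^\Downarrow=(E_0^*V+\cdots+E_i^*V)\cap(E_0V+\cdots+E_{d-i}V)$. It is known that $V=\bigoplus_{i=0}^dU_i=\bigoplus_{i=0}^dU_i^\Downarrow$, with all summands nonzero. For $0\le i\le d/2$ let $K_i=(E_0^*V+\cdots+E_i^*V)\cap(E_iV+\cdots+E_{d-i}V)=U_i\cap U_i^\Downarrow$. The maps. $K\in\mathrm{End}(V)$ acts on $U_i$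 as $q^{d-2i}I$, and $B\in\mathrm{End}(V)$ acts on $U_i^\Downarrow$ as $q^{d-2i}I$, for $0\le i\le d$; both are invertible. Put $R=A-aK-a^{-1}K^{-1}$. The map $\psi$ is the element of $\mathrm{End}(V)$, known to exist and be unique, such that $\psi R-R\psi=(q-q^{-1})(K-K^{-1})$ and $\psi K_i=0$ for $0\le i\le d/2$. *)

theory Defs
  imports "HOL-Computational_Algebra.Polynomial" "HOL-Library.Set_Algebras"
begin

text \<open>
  The vector space \<open>V\<close> is the whole type \<open>'v\<close>, with scalar multiplication
  \<open>s :: 'k \<Rightarrow> 'v \<Rightarrow> 'v\<close>; elements of \<open>End(V)\<close> are functions \<open>'v \<Rightarrow> 'v\<close> that are linear
  from \<open>s\<close> to \<open>s\<close>, and the product in \<open>End(V)\<close> is composition.  Sums of subspaces are the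
  elementwise sums of \<open>HOL-Library.Set_Algebras\<close>; the zero subspace is \<open>{0}\<close>.
\<close>

definition eigenspace ::
    "('k::field \<Rightarrow> 'v::ab_group_add \<Rightarrow> 'v) \<Rightarrow> ('v \<Rightarrow> 'v) \<Rightarrow> 'k \<Rightarrow> 'v set" where
  "eigenspace s T \<theta> = {v. T v = s \<theta> v}"

definition eigenspaces ::
    "('k::field \<Rightarrow> 'v::ab_group_add \<Rightarrow> 'v) \<Rightarrow> ('v \<Rightarrow> 'v) \<Rightarrow> 'v set set" where
  "eigenspaces s T = {eigenspace s T \<theta> |\<theta>. eigenspace s T \<theta> \<noteq> {0}}"

definition diagonalizable ::
    "('k::field \<Rightarrow> 'v::ab_group_add \<Rightarrow> 'v) \<Rightarrow> ('v \<Rightarrow> 'v) \<Rightarrow> bool" where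
  "diagonalizable s T \<longleftrightarrow>
     Vector_Spaces.linear s s T \<and> module.span s (\<Union>(eigenspaces s T)) = UNIV"

text \<open>
  \<open>V 0, \<dots>, V d\<close> is an ordering of the eigenspaces of \<open>T\<close>, without repetition, on which
  \<open>T'\<close> acts in a block tridiagonal fashion.
\<close>

definition standard_ordering ::
    "('k::field \<Rightarrow> 'v::ab_group_add \<Rightarrow> 'v) \<Rightarrow> ('v \<Rightarrow> 'v) \<Rightarrow> ('v \<Rightarrow> 'v)
      \<Rightarrow> nat \<Rightarrow> (nat \<Rightarrow> 'v set) \<Rightarrow> bool" where
  "standard_ordering s T T' d V \<longleftrightarrow>
     bij_betw V {0..d} (eigenspaces s T) \<and>
     (\<forall>i\<le>d. T' ` V i \<subseteq>
        (if i = 0 then {0} else V (i - 1)) + V i + (if i = d then {0} else V (i + 1)))"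

definition TD_pair ::
    "('k::field \<Rightarrow> 'v::ab_group_add \<Rightarrow> 'v) \<Rightarrow> ('v \<Rightarrow> 'v) \<Rightarrow> ('v \<Rightarrow> 'v) \<Rightarrow> bool" where
  "TD_pair s A As \<longleftrightarrow>
     diagonalizable s A \<and> diagonalizable s As \<and>
     (\<exists>d V. standard_ordering s A As d V) \<and>
     (\<exists>\<delta> Vs. standard_ordering s As A \<delta> Vs) \<and>
     \<not> (\<exists>W. module.subspace s W \<and> A ` W \<subseteq> W \<and> As ` W \<subseteq> W \<and> W \<noteq> {0} \<and> W \<noteq> UNIV)"

definition primitive_idempotent ::
    "('k::field \<Rightarrow> 'v::ab_group_add \<Rightarrow> 'v) \<Rightarrow> ('v \<Rightarrow> 'v) \<Rightarrow> 'v set \<Rightarrow> ('v \<Rightarrow> 'v) \<Rightarrow> bool" where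
  "primitive_idempotent s T W E \<longleftrightarrow>
     W \<in> eigenspaces s T \<and> Vector_Spaces.linear s s E \<and>
     (\<forall>v\<in>W. E v = v) \<and> (\<forall>v\<in>module.span s (\<Union>(eigenspaces s T - {W})). E v = 0)"

definition standard_idempotents ::
    "('k::field \<Rightarrow> 'v::ab_group_add \<Rightarrow> 'v) \<Rightarrow> ('v \<Rightarrow> 'v) \<Rightarrow> ('v \<Rightarrow> 'v)
      \<Rightarrow> nat \<Rightarrow> (nat \<Rightarrow> 'v \<Rightarrow> 'v) \<Rightarrow> bool" where
  "standard_idempotents s T T' d E \<longleftrightarrow>
     (\<exists>V. standard_ordering s T T' d V \<and> (\<forall>i\<le>d. primitive_idempotent s T (V i) (E i)))"

definition TD_system ::
    "('k::field \<Rightarrow> 'v::ab_group_add \<Rightarrow> 'v) \<Rightarrow> nat \<Rightarrow> ('v \<Rightarrow> 'v) \<Rightarrow> (nat \<Rightarrow> 'v \<Rightarrow> 'v)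
      \<Rightarrow> ('v \<Rightarrow> 'v) \<Rightarrow> (nat \<Rightarrow> 'v \<Rightarrow> 'v) \<Rightarrow> bool" where
  "TD_system s d A E As Es \<longleftrightarrow>
     TD_pair s A As \<and> standard_idempotents s A As d E \<and> standard_idempotents s As A d Es"

text \<open>
  For a primitive idempotent \<open>E\<close> of \<open>T\<close>, its range is a nonzero eigenspace, so at most one
  \<open>\<theta>\<close> satisfies \<open>range E = eigenspace s T \<theta>\<close>: the eigenvalue of \<open>T\<close> for \<open>E\<close>.
\<close>

definition q_Racah_type ::
    "('k::field \<Rightarrow> 'v::ab_group_add \<Rightarrow> 'v) \<Rightarrow> nat \<Rightarrow> ('v \<Rightarrow> 'v) \<Rightarrow> (nat \<Rightarrow> 'v \<Rightarrow> 'v)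
      \<Rightarrow> ('v \<Rightarrow> 'v) \<Rightarrow> (nat \<Rightarrow> 'v \<Rightarrow> 'v) \<Rightarrow> 'k \<Rightarrow> 'k \<Rightarrow> 'k \<Rightarrow> bool" where
  "q_Racah_type s d A E As Es q a b \<longleftrightarrow>
     q \<noteq> 0 \<and> a \<noteq> 0 \<and> b \<noteq> 0 \<and> q ^ 4 \<noteq> 1 \<and>
     (\<forall>i\<le>d.
        range (E i) = eigenspace s A
          (a * q powi (int d - 2 * int i) + inverse a * q powi (2 * int i - int d)) \<and>
        range (Es i) = eigenspace s As
          (b * q powi (int d - 2 * int i) + inverse b * q powi (2 * int i - int d)))"

definition split_space ::
    "nat \<Rightarrow> (nat \<Rightarrow> 'v \<Rightarrow> 'v::ab_group_add) \<Rightarrow> (nat \<Rightarrow> 'v \<Rightarrow> 'v) \<Rightarrow> nat \<Rightarrow> 'v set" where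
  "split_space d E Es i = (\<Sum>j=0..i. range (Es j)) \<inter> (\<Sum>j=i..d. range (E j))"

definition split_space_down ::
    "nat \<Rightarrow> (nat \<Rightarrow> 'v \<Rightarrow> 'v::ab_group_add) \<Rightarrow> (nat \<Rightarrow> 'v \<Rightarrow> 'v) \<Rightarrow> nat \<Rightarrow> 'v set" where
  "split_space_down d E Es i = (\<Sum>j=0..i. range (Es j)) \<inter> (\<Sum>j=0..d-i. range (E j))"

definition K_space ::
    "nat \<Rightarrow> (nat \<Rightarrow> 'v \<Rightarrow> 'v::ab_group_add) \<Rightarrow> (nat \<Rightarrow> 'v \<Rightarrow> 'v) \<Rightarrow> nat \<Rightarrow> 'v set" where
  "K_space d E Es i = (\<Sum>j=0..i. range (Es j)) \<inter> (\<Sum>j=i..d-i. range (E j))"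

definition acts_by_weights ::
    "('k::field \<Rightarrow> 'v::ab_group_add \<Rightarrow> 'v) \<Rightarrow> 'k \<Rightarrow> nat \<Rightarrow> (nat \<Rightarrow> 'v set) \<Rightarrow> ('v \<Rightarrow> 'v) \<Rightarrow> bool" where
  "acts_by_weights s q d U X \<longleftrightarrow>
     Vector_Spaces.linear s s X \<and>
     (\<forall>i\<le>d. \<forall>v\<in>U i. X v = s (q powi (int d - 2 * int i)) v)"

text \<open>
  \<open>inv K\<close> is the inverse in \<open>End(V)\<close> because \<open>K\<close>, acting by nonzero scalars on the
  summands of a direct sum decomposition of \<open>V\<close>, is bijective; the same holds for \<open>B\<close>.
\<close>

definition R_map ::
    "('k::field \<Rightarrow> 'v::ab_group_add \<Rightarrow> 'v) \<Rightarrow> 'k \<Rightarrow> ('v \<Rightarrow> 'v) \<Rightarrow> ('v \<Rightarrow> 'v) \<Rightarrow> 'v \<Rightarrow> 'v" where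
  "R_map s a A K = (\<lambda>v. A v - s a (K v) - s (inverse a) (inv K v))"

definition is_psi ::
    "('k::field \<Rightarrow> 'v::ab_group_add \<Rightarrow> 'v) \<Rightarrow> nat \<Rightarrow> ('v \<Rightarrow> 'v) \<Rightarrow> (nat \<Rightarrow> 'v \<Rightarrow> 'v)
      \<Rightarrow> (nat \<Rightarrow> 'v \<Rightarrow> 'v) \<Rightarrow> 'k \<Rightarrow> 'k \<Rightarrow> ('v \<Rightarrow> 'v) \<Rightarrow> ('v \<Rightarrow> 'v) \<Rightarrow> bool" where
  "is_psi s d A E Es q a K \<psi> \<longleftrightarrow>
     Vector_Spaces.linear s s \<psi> \<and>
     (\<forall>v. \<psi> (R_map s a A K v) - R_map s a A K (\<psi> v) = s (q - inverse q) (K v - inv K v)) \<and>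
     (\<forall>i. 2 * i \<le> d \<longrightarrow> (\<forall>v\<in>K_space d E Es i. \<psi> v = 0))"

definition is_quotient ::
    "('k::field \<Rightarrow> 'v::ab_group_add \<Rightarrow> 'v) \<Rightarrow> ('v \<Rightarrow> 'v) \<Rightarrow> ('v \<Rightarrow> 'v) \<Rightarrow> ('v \<Rightarrow> 'v) \<Rightarrow> bool" where
  "is_quotient s Z X Y \<longleftrightarrow>
     Vector_Spaces.linear s s X \<and> Vector_Spaces.linear s s Y \<and> bij Y \<and>
     X \<circ> Y = Y \<circ> X \<and> Z = X \<circ> inv Y \<and> Z = inv Y \<circ> X"

end

theory Submission
  imports Defs
begin

text \<open>
  Write \<open>K\<^sub>i\<close> for the spaces \<open>K_space d E Es i\<close>. On \<open>v \<in> K\<^sub>i\<close> the maps \<open>K\<close> and \<open>B\<close> act by one and the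
  same scalar and \<open>\<psi>\<close> vanishes, so there the claim \<open>q \<psi> (a K - a\<inverse> B) = K - B\<close> is trivial. The
  proof transports this equation from the \<open>K\<^sub>i\<close> to \<open>V\<close> by means of \<open>A\<close>.

  That \<open>A\<close> suffices is \<open>generated_by_kernel_parts\<close>: a subspace that contains every \<open>K\<^sub>i\<close> and is
  preserved by the raising maps \<open>A - \<theta>\<^sub>i\<close> of the split decomposition is all of \<open>V\<close>. Irreducibility
  enters through \<open>diagonal_trivial\<close>, applied to the given ordering of the eigenspaces of \<open>A\<close> and to
  the inverted one. It gives both split decompositions and the vanishing of
  \<open>(E\<^sub>0\<^sup>*V + \<cdots> + E\<^sub>i\<^sup>*V) \<inter> (E\<^sub>0V + \<cdots> + E\<^sub>jV)\<close> for \<open>i + j < d\<close>. From these,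
  \<open>(A - \<theta>\<^sub>i) \<cdots> (A - \<theta>\<^sub>d\<^sub>-\<^sub>i\<^sub>-\<^sub>1)\<close> maps \<open>U\<^sub>i\<close> onto \<open>U\<^sub>d\<^sub>-\<^sub>i\<close> (\<open>shifts_onto_opposite\<close>), and, as in the
  representation theory of \<open>sl\<^sub>2\<close>, every \<open>U\<^sub>i\<close> with \<open>2 i \<le> d\<close> is \<open>K\<^sub>i + (A - \<theta>\<^sub>i\<^sub>-\<^sub>1) U\<^sub>i\<^sub>-\<^sub>1\<close>.

  The rest is algebra with three exchange rules. Weight considerations give rules for \<open>K A\<close> and
  \<open>B A\<close> (\<open>weight_map_A\<close>), and the defining property of \<open>\<psi>\<close> gives one for \<open>\<psi> A\<close>. First, the defect
  \<open>K \<psi> - q\<^sup>2 \<psi> K\<close> commutes with \<open>R\<close> up to a scalar, so its kernel is all of \<open>V\<close>. Next, with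
  \<open>P = a q \<psi> - I\<close> and \<open>P' = a\<inverse> q \<psi> - I\<close>, the equation above reads \<open>P K = P' B\<close>, and the defect
  \<open>S = P K - P' B\<close> satisfies
  \<open>S A = q\<^sup>-\<^sup>2 A S + (1 - q\<^sup>-\<^sup>2) a\<inverse> (S B + K\<inverse> S)\<close>, whence \<open>S = 0\<close>.

  Invertibility of the denominators comes from the same equation: it implies
  \<open>P' (a K - a\<inverse> B) = (a\<inverse> - a) K\<close>, and \<open>a\<inverse> \<noteq> a\<close> because \<open>\<theta>\<^sub>0 \<noteq> \<theta>\<^sub>d\<close>. Each denominator is
  \<open>a K - a\<inverse> B\<close> composed with \<open>K\<inverse>\<close> or \<open>B\<inverse>\<close> on one side, up to a scalar.
\<close>

section \<open>Spectral resolutions\<close>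

text \<open>
  A diagonalizable map \<open>T\<close> is handled through its primitive idempotents: a complete orthogonal
  family of projections that intertwine \<open>T\<close> with multiplication by pairwise distinct scalars.
  Then every equation between vectors can be checked one component at a time.
\<close>

locale spectral_resolution = vector_space s
  for s :: "'k::field \<Rightarrow> 'v::ab_group_add \<Rightarrow> 'v" (infixr "*s" 75) +
  fixes d :: nat and T :: "'v \<Rightarrow> 'v" and E :: "nat \<Rightarrow> 'v \<Rightarrow> 'v" and \<theta> :: "nat \<Rightarrow> 'k"
  assumes linear_T: "Vector_Spaces.linear s s T"
    and linear_E: "i \<le> d \<Longrightarrow> Vector_Spaces.linear s s (E i)"
    and E_E: "i \<le> d \<Longrightarrow> j \<le> d \<Longrightarrow> E i (E j v) = (if i = j then E i v else 0)"
    and sum_E: "(\<Sum>i\<le>d. E i v) = v"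
    and E_T: "i \<le> d \<Longrightarrow> E i (T v) = \<theta> i *s E i v"
    and inj_theta: "inj_on \<theta> {..d}"
    and E_nonzero: "i \<le> d \<Longrightarrow> \<exists>v. E i v \<noteq> 0"
begin

sublocale endo: vector_space_pair s s ..

lemmas T_simps = endo.linear_add[OF linear_T] endo.linear_diff[OF linear_T]
  endo.linear_scale[OF linear_T] endo.linear_0[OF linear_T] endo.linear_sum[OF linear_T]

lemmas E_simps = endo.linear_add[OF linear_E] endo.linear_diff[OF linear_E]
  endo.linear_scale[OF linear_E] endo.linear_0[OF linear_E] endo.linear_sum[OF linear_E]

lemma eq_by_components:
  assumes "\<And>k. k \<le> d \<Longrightarrow> E k x = E k y"
  shows "x = y"
proof -
  have "(\<Sum>i\<le>d. E i x) = (\<Sum>i\<le>d. E i y)"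
    using assms by (intro sum.cong) auto
  then show ?thesis by (simp add: sum_E)
qed

text \<open>
  The sum of the \<open>E j V\<close> over \<open>j \<in> J\<close>, described by the components that vanish: in this form
  intersections of such sums are intersections of index sets.
\<close>

definition comps :: "nat set \<Rightarrow> 'v set" where
  "comps J = {v. \<forall>k\<le>d. k \<notin> J \<longrightarrow> E k v = 0}"

lemma subspace_comps: "subspace (comps J)"
  by (auto simp: comps_def subspace_def E_simps)

lemma range_subset_comps: "i \<le> d \<Longrightarrow> i \<in> J \<Longrightarrow> E i v \<in> comps J"
  by (auto simp: comps_def E_E)

lemma sum_of_ranges:
  assumes J: "J \<subseteq> {..d}"
  shows "(\<Sum>j\<in>J. range (E j)) = comps J"
proof -
  have "finite J" using J finite_subset by blast
  note sum_eq = set_sum_alt[OF this, of "\<lambda>j. range (E j)"]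
  show ?thesis unfolding sum_eq
  proof (intro set_eqI iffI)
    fix x assume "x \<in> {sum f J |f. \<forall>j\<in>J. f j \<in> range (E j)}"
    then obtain f where f: "\<forall>j\<in>J. f j \<in> range (E j)" "x = sum f J"
      by blast
    have "f j \<in> comps J" if "j \<in> J" for j
    proof -
      obtain y where "f j = E j y" using f(1) \<open>j \<in> J\<close> by blast
      then show ?thesis using range_subset_comps[of j J y] that J by auto
    qed
    then show "x \<in> comps J"
      unfolding f(2) by (intro subspace_sum subspace_comps) auto
  next
    fix x assume x: "x \<in> comps J"
    have "x = (\<Sum>j\<le>d. E j x)" by (simp add: sum_E)
    also have "\<dots> = (\<Sum>j\<in>J. E j x)"
      using x J by (intro sum.mono_neutral_right) (auto simp: comps_def)
    finally show "x \<in> {sum f J |f. \<forall>j\<in>J. f j \<in> range (E j)}" by blast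
  qed
qed

lemma E_shift: "k \<le> d \<Longrightarrow> E k (T v - c *s v) = (\<theta> k - c) *s E k v"
  by (simp add: E_simps E_T scale_left_diff_distrib)

lemma theta_neq: "i \<le> d \<Longrightarrow> j \<le> d \<Longrightarrow> i \<noteq> j \<Longrightarrow> \<theta> i - \<theta> j \<noteq> 0"
  using inj_theta by (auto simp: inj_on_def)

text \<open>
  \<open>T - \<theta>\<^sub>j\<close> scales the component of index \<open>k\<close> by \<open>\<theta>\<^sub>k - \<theta>\<^sub>j\<close>, which can be divided by
  unless \<open>k = j\<close>.
\<close>

lemma shift_preimage:
  assumes j: "j \<le> d" and u: "E j u = 0"
  shows "\<exists>w. T w - \<theta> j *s w = u"
proof -
  define w where "w = (\<Sum>k\<in>{..d} - {j}. inverse (\<theta> k - \<theta> j) *s E k u)"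
  have "E m (T w - \<theta> j *s w) = E m u" if m: "m \<le> d" for m
  proof (cases "m = j")
    case True
    then show ?thesis using m u by (simp add: E_shift)
  next
    case False
    have "E m w = (\<Sum>k\<in>{..d} - {j}. inverse (\<theta> k - \<theta> j) *s E m (E k u))"
      unfolding w_def using m by (simp add: E_simps)
    also have "\<dots> = (\<Sum>k\<in>{..d} - {j}. if k = m then inverse (\<theta> m - \<theta> j) *s E m u else 0)"
      using m by (intro sum.cong) (auto simp: E_E)
    also have "\<dots> = inverse (\<theta> m - \<theta> j) *s E m u"
      using m False by simp
    finally show ?thesis
      using theta_neq[OF m j False] m by (simp add: E_shift)
  qed
  then have "T w - \<theta> j *s w = u" by (rule eq_by_components)
  then show ?thesis by blast
qed

text \<open>
  \<open>shifts i n\<close> is \<open>(T - \<theta>\<^sub>i\<^sub>+\<^sub>n\<^sub>-\<^sub>1) \<cdots> (T - \<theta>\<^sub>i\<^sub>+\<^sub>1) (T - \<theta>\<^sub>i)\<close>. The factors commute; the factor of lowest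
  index is applied first because this is the order in which a vector climbs the split
  decomposition.
\<close>

fun shifts :: "nat \<Rightarrow> nat \<Rightarrow> 'v \<Rightarrow> 'v" where
  "shifts i 0 v = v"
| "shifts i (Suc n) v = shifts (Suc i) n (T v - \<theta> i *s v)"

lemma shifts_diff: "shifts i n (x - y) = shifts i n x - shifts i n y"
proof (induction n arbitrary: i x y)
  case (Suc n)
  have "T (x - y) - \<theta> i *s (x - y) = (T x - \<theta> i *s x) - (T y - \<theta> i *s y)"
    by (simp add: T_simps scale_right_diff_distrib)
  then show ?case using Suc.IH by simp
qed simp

lemma E_shifts_eq_0_iff:
  assumes "k \<le> d" "i + n \<le> Suc d"
  shows "E k (shifts i n v) = 0 \<longleftrightarrow> k \<in> {i..<i + n} \<or> E k v = 0"
  using assms(2)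
proof (induction n arbitrary: i v)
  case (Suc n)
  have "E k (shifts i (Suc n) v) = 0
      \<longleftrightarrow> k \<in> {Suc i..<Suc i + n} \<or> E k (T v - \<theta> i *s v) = 0"
    using Suc.IH[of "Suc i"] Suc.prems by simp
  also have "E k (T v - \<theta> i *s v) = 0 \<longleftrightarrow> k = i \<or> E k v = 0"
    using theta_neq[of k i] assms(1) Suc.prems by (auto simp: E_shift)
  finally show ?case by auto
qed simp

lemma shifts_preimage:
  assumes "i + n \<le> Suc d" "\<And>k. k \<in> {i..<i + n} \<Longrightarrow> E k u = 0"
  shows "\<exists>w. shifts i n w = u"
  using assms
proof (induction n arbitrary: i)
  case (Suc n)
  obtain w where w: "shifts (Suc i) n w = u"
    using Suc.IH[of "Suc i"] Suc.prems by auto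
  have "E i w = 0"
    using E_shifts_eq_0_iff[of i "Suc i" n w] w Suc.prems by simp
  then obtain w' where "T w' - \<theta> i *s w' = w"
    using shift_preimage[of i w] Suc.prems by auto
  then show ?case using w by auto
qed simp

text \<open>
  Inverting the order of the eigenspaces of \<open>A\<close> turns one split decomposition into the other,
  so that results for the first apply to the second.
\<close>

lemma spectral_resolution_reversed:
  "spectral_resolution s d T (\<lambda>k. E (d - k)) (\<lambda>k. \<theta> (d - k))"
proof unfold_locales
  show "(\<Sum>i\<le>d. E (d - i) v) = v" for v
    using sum.atLeastAtMost_rev[of "\<lambda>i. E i v" 0 d] sum_E[of v]
    by (simp add: atLeast0AtMost)
  show "inj_on (\<lambda>k. \<theta> (d - k)) {..d}"
  proof (rule inj_onI)
    fix x y assume "x \<in> {..d}" "y \<in> {..d}" "\<theta> (d - x) = \<theta> (d - y)"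
    then show "x = y" using inj_onD[OF inj_theta, of "d - x" "d - y"] by auto
  qed
qed (auto simp: T_simps E_simps E_E E_T E_nonzero)

end

section \<open>The split decomposition\<close>

locale tridiagonal_system =
  spectral_resolution s d A E \<theta> + star: spectral_resolution s d As Es \<theta>s
  for s :: "'k::field \<Rightarrow> 'v::ab_group_add \<Rightarrow> 'v" (infixr "*s" 75)
    and d :: nat and A As :: "'v \<Rightarrow> 'v" and E Es :: "nat \<Rightarrow> 'v \<Rightarrow> 'v" and \<theta> \<theta>s :: "nat \<Rightarrow> 'k" +
  assumes tridiagonal: "i \<le> d \<Longrightarrow> k \<le> d \<Longrightarrow> i + 1 < k \<or> k + 1 < i \<Longrightarrow> E k (As (E i v)) = 0"
    and tridiagonal_star: "i \<le> d \<Longrightarrow> k \<le> d \<Longrightarrow> i + 1 < k \<or> k + 1 < i \<Longrightarrow> Es k (A (Es i v)) = 0"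
    and irreducible: "subspace W \<Longrightarrow> A ` W \<subseteq> W \<Longrightarrow> As ` W \<subseteq> W \<Longrightarrow> W = {0} \<or> W = UNIV"
begin

lemma tridiagonal_system_reversed:
  "tridiagonal_system s d A As (\<lambda>k. E (d - k)) Es (\<lambda>k. \<theta> (d - k)) \<theta>s"
proof (intro tridiagonal_system.intro tridiagonal_system_axioms.intro)
  show "spectral_resolution s d A (\<lambda>k. E (d - k)) (\<lambda>k. \<theta> (d - k))"
    by (rule spectral_resolution_reversed)
  show "spectral_resolution s d As Es \<theta>s" by unfold_locales
  show "E (d - k) (As (E (d - i) v)) = 0"
    if "i \<le> d" "k \<le> d" "i + 1 < k \<or> k + 1 < i" for i k v
    by (rule tridiagonal) (use that in auto)
qed (fact tridiagonal_star irreducible)+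

text \<open>
  The diagonal entries \<open>split_part i i\<close> are the summands of the split decomposition. The
  off-diagonal entries are included because their vanishing above the diagonal is what makes that
  sum direct.
\<close>

definition split_part :: "nat \<Rightarrow> nat \<Rightarrow> 'v set" where
  "split_part i j = star.comps {..i} \<inter> comps {j..}"

lemma split_part_iff:
  "v \<in> split_part i j \<longleftrightarrow> (\<forall>k\<le>d. i < k \<longrightarrow> Es k v = 0) \<and> (\<forall>k\<le>d. k < j \<longrightarrow> E k v = 0)"
  by (auto simp: split_part_def comps_def star.comps_def not_le)

lemma subspace_split_part: "subspace (split_part i j)"
  unfolding split_part_def by (intro subspace_inter subspace_comps star.subspace_comps)

text \<open>
  This is the tridiagonal action of \<open>A\<close> on the eigenspaces of \<open>As\<close>; the scalar is arbitrary
  because the flag is increasing.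
\<close>

lemma A_raises_flag:
  assumes v: "v \<in> star.comps {..i}"
  shows "A v - c *s v \<in> star.comps {..Suc i}"
proof -
  have "Es k (A v - c *s v) = 0" if k: "k \<le> d" "Suc i < k" for k
  proof -
    have "Es k (A v) = (\<Sum>l\<le>d. Es k (A (Es l v)))"
      by (subst star.sum_E[of v, symmetric]) (simp add: T_simps star.E_simps k)
    also have "\<dots> = 0"
    proof (rule sum.neutral, rule ballI)
      fix l assume "l \<in> {..d}"
      then show "Es k (A (Es l v)) = 0"
        using tridiagonal_star[of l k v] v k
        by (cases "l \<le> i") (auto simp: star.comps_def T_simps star.E_simps)
    qed
    finally show ?thesis
      using v k by (simp add: star.comps_def star.E_simps)
  qed
  then show ?thesis by (auto simp: star.comps_def)
qed

lemma shifts_flag: "v \<in> star.comps {..i} \<Longrightarrow> shifts m n v \<in> star.comps {..i + n}"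
proof (induction n arbitrary: i m v)
  case (Suc n)
  then show ?case using Suc.IH[OF A_raises_flag[OF Suc.prems]] by simp
qed simp

text \<open>
  \<open>A - \<theta>\<^sub>j\<close> kills the component of index \<open>j\<close>, so the lower end of the second index range moves up.
\<close>

lemma A_raises_split:
  assumes v: "v \<in> split_part i j"
  shows "A v - \<theta> j *s v \<in> split_part (Suc i) (Suc j)"
proof -
  have "A v - \<theta> j *s v \<in> star.comps {..Suc i}"
    using v by (intro A_raises_flag) (simp add: split_part_def)
  moreover have "E k (A v - \<theta> j *s v) = 0" if "k \<le> d" "k < Suc j" for k
    using v that by (cases "k = j") (auto simp: split_part_iff E_shift)
  ultimately show ?thesis by (auto simp: split_part_iff star.comps_def)
qed

text \<open>
  Dually, \<open>As - \<theta>s\<^sub>i\<close> kills the component of index \<open>i\<close>. The case \<open>i = 0\<close> is recorded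
  separately: there \<open>i - 1\<close> is truncated while no smaller flag is left.
\<close>

lemma As_lowers_split:
  assumes v: "v \<in> split_part i j"
  shows "As v - \<theta>s i *s v \<in> split_part (i - 1) (j - 1)"
    and "i = 0 \<Longrightarrow> As v - \<theta>s i *s v = 0"
proof -
  have E0: "E k (As v - \<theta>s i *s v) = 0" if k: "k \<le> d" "k < j - 1" for k
  proof -
    have "E k (As v) = (\<Sum>l\<le>d. E k (As (E l v)))"
      by (subst sum_E[of v, symmetric]) (simp add: star.T_simps E_simps k)
    also have "\<dots> = 0"
    proof (rule sum.neutral, rule ballI)
      fix l assume "l \<in> {..d}"
      then show "E k (As (E l v)) = 0"
      proof (cases "l < j")
        case True
        then show ?thesis
          using v k \<open>l \<in> {..d}\<close> by (simp add: split_part_iff star.T_simps E_simps)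
      next
        case False
        then have "k + 1 < l" using k by linarith
        then show ?thesis using tridiagonal[of l k v] k \<open>l \<in> {..d}\<close> by simp
      qed
    qed
    finally show ?thesis
      using v k by (simp add: split_part_iff E_simps)
  qed
  have Es0: "Es k (As v - \<theta>s i *s v) = 0" if "k \<le> d" "i \<le> k" for k
    using v that by (cases "k = i") (auto simp: split_part_iff star.E_shift)
  show "As v - \<theta>s i *s v \<in> split_part (i - 1) (j - 1)"
    using E0 Es0 by (simp add: split_part_iff)
  show "As v - \<theta>s i *s v = 0" if "i = 0"
    by (rule star.eq_by_components) (use Es0 that in \<open>simp add: star.E_simps\<close>)
qed

text \<open>
  \<open>A\<close> moves each entry of a diagonal of the array \<open>split_part\<close> into itself plus the next entry,
  and \<open>As\<close> moves it into itself plus the previous one; so the span of the diagonal is invariant,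
  and irreducibility applies.
\<close>

lemma diagonal_trivial:
  "span (\<Union>i. split_part i (i + r)) = {0} \<or> span (\<Union>i. split_part i (i + r)) = UNIV"
proof (rule irreducible)
  let ?W = "span (\<Union>i. split_part i (i + r))"
  have in_W: "v \<in> ?W" if "v \<in> split_part i (i + r)" for i v
    using that by (intro span_base) auto
  show "subspace ?W" by simp
  have "?W \<subseteq> A -` ?W"
  proof (rule span_minimal)
    show "(\<Union>i. split_part i (i + r)) \<subseteq> A -` ?W"
    proof (clarsimp)
      fix i v assume v: "v \<in> split_part i (i + r)"
      have "A v = (A v - \<theta> (i + r) *s v) + \<theta> (i + r) *s v" by simp
      also have "\<dots> \<in> ?W"
        using A_raises_split[OF v] in_W[of _ "Suc i"] in_W[OF v] by (intro span_add span_scale) auto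
      finally show "A v \<in> ?W" .
    qed
    show "subspace (A -` ?W)"
      by (auto simp: subspace_def T_simps span_add span_scale span_zero)
  qed
  then show "A ` ?W \<subseteq> ?W" by auto
  have "?W \<subseteq> As -` ?W"
  proof (rule span_minimal)
    show "(\<Union>i. split_part i (i + r)) \<subseteq> As -` ?W"
    proof (clarsimp)
      fix i v assume v: "v \<in> split_part i (i + r)"
      have "As v - \<theta>s i *s v \<in> ?W"
        using As_lowers_split[OF v] in_W[of _ "i - 1"] by (cases i) (auto simp: span_zero)
      then have "(As v - \<theta>s i *s v) + \<theta>s i *s v \<in> ?W"
        using in_W[OF v] by (intro span_add span_scale) auto
      then show "As v \<in> ?W" by simp
    qed
    show "subspace (As -` ?W)"
      by (auto simp: subspace_def star.T_simps span_add span_scale span_zero)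
  qed
  then show "As ` ?W \<subseteq> ?W" by auto
qed

text \<open>
  For \<open>i < j\<close> the span of the diagonal through \<open>split_part i j\<close> has no component of index 0
  with respect to \<open>A\<close>, hence is not \<open>V\<close>.
\<close>

lemma split_part_above_diagonal:
  assumes "i < j"
  shows "split_part i j = {0}"
proof -
  let ?W = "span (\<Union>l. split_part l (l + (j - i)))"
  have sub: "?W \<subseteq> comps {1..}"
    using assms by (intro span_minimal subspace_comps) (auto simp: split_part_def comps_def)
  obtain v where "E 0 v \<noteq> 0" using E_nonzero by blast
  then have "v \<notin> comps {1..}" by (auto simp: comps_def)
  then have "?W = {0}" using diagonal_trivial[of "j - i"] sub by blast
  moreover have "split_part i (i + (j - i)) \<subseteq> ?W"
    by (intro subset_trans[OF _ span_superset] UN_upper UNIV_I)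
  then have "split_part i j \<subseteq> ?W" using assms by simp
  ultimately show ?thesis
    using subspace_0[OF subspace_split_part, of i j] by blast
qed

lemma split_part_beyond:
  assumes "d < j"
  shows "split_part i j = {0}"
proof -
  have "x = 0" if "x \<in> split_part i j" for x
    by (rule eq_by_components) (use that assms in \<open>simp add: split_part_iff E_simps\<close>)
  then show ?thesis using subspace_0[OF subspace_split_part] by blast
qed

text \<open>
  The main diagonal contains \<open>split_part 0 0\<close>, the range of \<open>Es 0\<close>, hence is not zero.
\<close>

lemma split_spaces_span:
  assumes W: "subspace W" "\<And>i. i \<le> d \<Longrightarrow> split_part i i \<subseteq> W"
  shows "W = UNIV"
proof -
  let ?D = "span (\<Union>i. split_part i (i + 0))"
  obtain v where v: "Es 0 v \<noteq> 0" using star.E_nonzero by blast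
  have "Es 0 v \<in> split_part 0 (0 + 0)" by (auto simp: split_part_iff star.E_E)
  then have "Es 0 v \<in> ?D" by (intro span_base) blast
  then have "?D = UNIV" using v diagonal_trivial[of 0] by blast
  moreover have "split_part i i \<subseteq> W" for i
  proof (cases "i \<le> d")
    case False
    then show ?thesis using split_part_beyond[of i i] W(1) subspace_0 by simp
  qed (rule W(2))
  then have "?D \<subseteq> W" using W(1) by (intro span_minimal) auto
  ultimately show ?thesis by blast
qed

text \<open>
  Each summand \<open>split_part l l\<close> lies in the first of the two spaces if \<open>l \<le> i\<close>, and in the
  second one otherwise.
\<close>

lemma flag_decomposition:
  "\<exists>f g. v = f + g \<and> f \<in> star.comps {..i} \<and> g \<in> comps {Suc i..}"
proof -
  let ?W = "{f + g |f g. f \<in> star.comps {..i} \<and> g \<in> comps {Suc i..}}"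
  have sub: "subspace ?W"
    by (intro subspace_sums subspace_comps star.subspace_comps)
  have "split_part l l \<subseteq> ?W" for l
  proof
    fix x assume x: "x \<in> split_part l l"
    show "x \<in> ?W"
    proof (cases "l \<le> i")
      case True
      then have "x \<in> star.comps {..i}" using x by (auto simp: split_part_iff star.comps_def)
      moreover have "0 \<in> comps {Suc i..}" using subspace_0 subspace_comps by blast
      ultimately show ?thesis by force
    next
      case False
      then have "x \<in> comps {Suc i..}" using x by (auto simp: split_part_iff comps_def)
      moreover have "0 \<in> star.comps {..i}" using subspace_0 star.subspace_comps by blast
      ultimately show ?thesis by force
    qed
  qed
  then have "?W = UNIV" using sub by (intro split_spaces_span) auto
  then show ?thesis by blast
qed

lemma shifts_split: "v \<in> split_part r i \<Longrightarrow> shifts i n v \<in> split_part (r + n) (i + n)"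
proof (induction n arbitrary: i r v)
  case (Suc n)
  then show ?case using Suc.IH[OF A_raises_split[OF Suc.prems]] by simp
qed simp

section \<open>Raising from the lower half of the split decomposition\<close>

text \<open>
  Let \<open>P\<close> be the product of the shifts \<open>A - \<theta>\<^sub>k\<close> for \<open>i \<le> k < j\<close>. A preimage \<open>w\<close> of \<open>u\<close> under \<open>P\<close>
  is \<open>f + h\<close> with \<open>f\<close> in the flag \<open>Es 0 V + \<cdots> + Es i V\<close> and \<open>h\<close> in \<open>E 0 V + \<cdots> + E (j - 1) V\<close>, by
  the decomposition for the inverted order. Then \<open>P h = u - P f\<close> lies in the \<open>j\<close>-th flag space and in
  \<open>E 0 V + \<cdots> + E (i - 1) V\<close>, and these intersect trivially because \<open>j + (i - 1) < d\<close>. Hence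
  \<open>P f = u\<close>, and \<open>f\<close> has no component of index below \<open>i\<close> since \<open>P\<close> does not annihilate such
  components.
\<close>

lemma shifts_onto_opposite:
  assumes ij: "i \<le> j" "i + j = d" and u: "u \<in> split_part j j"
  shows "\<exists>f\<in>split_part i i. shifts i (j - i) f = u"
proof (cases "i = j")
  case False
  interpret rev: tridiagonal_system s d A As "\<lambda>k. E (d - k)" Es "\<lambda>k. \<theta> (d - k)" \<theta>s
    by (rule tridiagonal_system_reversed)
  let ?P = "shifts i (j - i)"
  obtain w where w: "?P w = u"
    using shifts_preimage[of i "j - i" u] u ij by (auto simp: split_part_iff)
  obtain f h where fh: "w = f + h" "f \<in> star.comps {..i}" "h \<in> rev.comps {Suc i..}"
    using rev.flag_decomposition by blast
  have Ph: "?P h = u - ?P f"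
    using w fh(1) shifts_diff[of i "j - i" w f] by simp
  have "u \<in> star.comps {..j}" "?P f \<in> star.comps {..j}"
    using u shifts_flag[OF fh(2), of i "j - i"] ij by (auto simp: split_part_def)
  then have "?P h \<in> star.comps {..j}"
    unfolding Ph by (intro subspace_diff star.subspace_comps)
  moreover have "E (d - k) (?P h) = 0" if "k \<le> d" "k < Suc j" for k
  proof -
    have "d - k \<in> {i..<i + (j - i)} \<or> E (d - k) h = 0"
    proof (cases "k \<le> i")
      case True
      then show ?thesis using fh(3) that(1) by (simp add: rev.comps_def)
    next
      case False
      then show ?thesis using that ij by auto
    qed
    then show ?thesis using E_shifts_eq_0_iff[of "d - k" i "j - i" h] ij by auto
  qed
  ultimately have "?P h \<in> rev.split_part j (Suc j)"
    by (auto simp: rev.split_part_def rev.comps_def)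
  then have "?P f = u"
    using rev.split_part_above_diagonal[of j "Suc j"] Ph by auto
  moreover have "f \<in> split_part i i"
  proof -
    have "E k f = 0" if "k \<le> d" "k < i" for k
      using E_shifts_eq_0_iff[of k i "j - i" f] \<open>?P f = u\<close> u that ij
      by (auto simp: split_part_iff)
    then show ?thesis using fh(2) by (auto simp: split_part_iff star.comps_def)
  qed
  ultimately show ?thesis by blast
qed (use u in auto)

text \<open>
  These are the spaces \<open>K\<^sub>i\<close>. For \<open>2 i \<le> d\<close> the space is the kernel of
  \<open>(A - \<theta>\<^sub>i) \<cdots> (A - \<theta>\<^sub>d\<^sub>-\<^sub>i)\<close> on \<open>split_part i i\<close>, hence the name.
\<close>

definition kernel_part :: "nat \<Rightarrow> 'v set" where
  "kernel_part i = star.comps {..i} \<inter> comps {i..d - i}"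

lemma kernel_partI:
  assumes "v \<in> split_part i i" "\<And>k. k \<le> d \<Longrightarrow> d - i < k \<Longrightarrow> E k v = 0"
  shows "v \<in> kernel_part i"
proof -
  have "E k v = 0" if "k \<le> d" "k \<notin> {i..d - i}" for k
    using assms that by (cases "k < i") (auto simp: split_part_iff)
  then show ?thesis using assms(1) by (simp add: kernel_part_def split_part_def comps_def)
qed

text \<open>
  Send \<open>u\<close> by \<open>d - 2 i + 1\<close> shifts into \<open>split_part (d - i + 1) (d - i + 1)\<close>. That space is the
  image of \<open>split_part (i - 1) (i - 1)\<close> under one shift more, which provides \<open>w\<close>; the difference in
  question is annihilated by the shifts.
\<close>

lemma split_part_lower_half:
  assumes i: "0 < i" "2 * i \<le> d" and u: "u \<in> split_part i i"
  shows "\<exists>w\<in>split_part (i - 1) (i - 1). u - (A w - \<theta> (i - 1) *s w) \<in> kernel_part i"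
proof -
  let ?n = "d - 2 * i + 1"
  have "shifts i ?n u \<in> split_part (d - i + 1) (d - i + 1)"
    using shifts_split[OF u, of ?n] i by (simp add: algebra_simps numeral_eq_Suc)
  then have "\<exists>w\<in>split_part (i - 1) (i - 1). shifts (i - 1) (d - i + 1 - (i - 1)) w = shifts i ?n u"
    using i by (intro shifts_onto_opposite) auto
  then obtain w where w: "w \<in> split_part (i - 1) (i - 1)"
    and "shifts (i - 1) (d - i + 1 - (i - 1)) w = shifts i ?n u"
    by blast
  moreover have "d - i + 1 - (i - 1) = Suc ?n" "Suc (i - 1) = i" using i by auto
  ultimately have eq: "shifts i ?n (A w - \<theta> (i - 1) *s w) = shifts i ?n u"
    by simp
  let ?k = "u - (A w - \<theta> (i - 1) *s w)"
  have "A w - \<theta> (i - 1) *s w \<in> split_part i i"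
    using A_raises_split[OF w] i by simp
  then have "?k \<in> split_part i i" using u by (rule subspace_diff[OF subspace_split_part, rotated])
  moreover have "E k ?k = 0" if "k \<le> d" "d - i < k" for k
  proof -
    \<comment> \<open>The \<open>?n\<close> shifts have the indices \<open>i, \<dots>, d - i\<close> and are injective on the other components.\<close>
    have "shifts i ?n ?k = 0" using eq by (simp add: shifts_diff)
    then show ?thesis
      using E_shifts_eq_0_iff[of k i ?n ?k] that i by (auto simp: E_simps)
  qed
  ultimately have "?k \<in> kernel_part i" by (rule kernel_partI)
  then show ?thesis using w by blast
qed

text \<open>
  In the lower half of the split decomposition this is an induction on the index, by
  \<open>split_part_lower_half\<close>; the upper half is obtained from the lower by shifts.
\<close>

lemma generated_by_kernel_parts:
  assumes W: "subspace W"
    and kernel: "\<And>i. 2 * i \<le> d \<Longrightarrow> kernel_part i \<subseteq> W"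
    and raise: "\<And>i v. i \<le> d \<Longrightarrow> v \<in> W \<Longrightarrow> v \<in> split_part i i \<Longrightarrow> A v - \<theta> i *s v \<in> W"
  shows "W = UNIV"
proof (rule split_spaces_span[OF W])
  have lower: "split_part i i \<subseteq> W" if "2 * i \<le> d" for i
    using that
  proof (induction i)
    case 0
    have "split_part 0 0 = kernel_part 0"
      by (auto simp: split_part_iff kernel_part_def comps_def star.comps_def)
    then show ?case using kernel[of 0] by simp
  next
    case (Suc i)
    show ?case
    proof
      fix u assume "u \<in> split_part (Suc i) (Suc i)"
      then obtain w where w: "w \<in> split_part i i" "u - (A w - \<theta> i *s w) \<in> W"
        using split_part_lower_half[of "Suc i" u] Suc.prems kernel[of "Suc i"] by auto
      then have "A w - \<theta> i *s w \<in> W" using Suc raise[of i w] by auto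
      from subspace_add[OF W w(2) this] show "u \<in> W" by simp
    qed
  qed
  have shifts_in_W: "shifts i n v \<in> W" if "v \<in> W" "v \<in> split_part i i" "i + n \<le> d" for i n v
    using that
  proof (induction n arbitrary: i v)
    case (Suc n)
    then show ?case using raise[of i v] A_raises_split[of v i i] by auto
  qed simp
  show "split_part j j \<subseteq> W" if jd: "j \<le> d" for j
  proof (cases "2 * j \<le> d")
    case False
    show ?thesis
    proof
      fix u assume "u \<in> split_part j j"
      then obtain f where f: "f \<in> split_part (d - j) (d - j)" "shifts (d - j) (j - (d - j)) f = u"
        using shifts_onto_opposite[of "d - j" j u] False jd by auto
      have "2 * (d - j) \<le> d" using False by simp
      then show "u \<in> W" using lower f shifts_in_W[of f "d - j" "j - (d - j)"] jd False by auto
    qed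
  qed (simp add: lower)
qed

end

section \<open>Operators acting by weights on the split decomposition\<close>

context tridiagonal_system
begin

text \<open>
  The exchange rule for a map \<open>X\<close> that acts on the split decomposition by scalars in geometric
  progression: on \<open>split_part i i\<close> write \<open>A = \<theta>\<^sub>i + (A - \<theta>\<^sub>i)\<close>, where the second term raises the
  index and so changes the weight by the factor \<open>p\<close>.
\<close>

lemma weight_map_A:
  fixes \<kappa> :: "nat \<Rightarrow> 'k"
  assumes X: "Vector_Spaces.linear s s X" "\<And>i v. i \<le> d \<Longrightarrow> v \<in> split_part i i \<Longrightarrow> X v = \<kappa> i *s v"
    and theta: "\<And>i. i \<le> d \<Longrightarrow> \<theta> i * \<kappa> i = x * (\<kappa> i * \<kappa> i) + y"
    and step: "\<And>i. \<kappa> (Suc i) = p * \<kappa> i"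
  shows "X (A v) = p *s A (X v) + (1 - p) *s (x *s X (X v) + y *s v)"
proof -
  note X_simps = endo.linear_add[OF X(1)] endo.linear_diff[OF X(1)]
    endo.linear_scale[OF X(1)] endo.linear_0[OF X(1)]
  define D where "D v = X (A v) - (p *s A (X v) + (1 - p) *s (x *s X (X v) + y *s v))" for v
  have D_simps: "D (u + v) = D u + D v" "D (c *s v) = c *s D v" "D 0 = 0" for c u v
    by (simp_all add: D_def X_simps T_simps algebra_simps)
  let ?W = "{v. D v = 0}"
  have "subspace ?W"
    by (auto simp: subspace_def D_simps)
  moreover have "split_part i i \<subseteq> ?W" if i: "i \<le> d" for i
  proof
    fix v assume v: "v \<in> split_part i i"
    \<comment> \<open>For \<open>i = d\<close> there is no weight of index \<open>Suc i\<close>; then \<open>w = 0\<close>.\<close>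
    define w where "w = A v - \<theta> i *s v"
    have "w \<in> split_part (Suc i) (Suc i)" unfolding w_def by (rule A_raises_split[OF v])
    then have Xw: "X w = (p * \<kappa> i) *s w"
      using X(2)[of "Suc i" w] split_part_beyond[of "Suc i"] step[of i]
      by (cases "Suc i \<le> d") (auto simp: X_simps)
    have Av: "A v = w + \<theta> i *s v" by (simp add: w_def)
    have "X (A v) = (p * \<kappa> i) *s w + (\<theta> i * \<kappa> i) *s v"
      using X(2)[OF i v] Xw by (simp add: Av X_simps)
    also have "\<dots> = (p * \<kappa> i) *s w + (p * (\<theta> i * \<kappa> i)) *s v + ((1 - p) * (\<theta> i * \<kappa> i)) *s v"
      by (simp add: algebra_simps)
    also have "\<dots> = p *s A (X v) + (1 - p) *s (x *s X (X v) + y *s v)"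
      unfolding theta[OF i, THEN arg_cong, of "\<lambda>t. ((1 - p) * t) *s v"]
      using X(2)[OF i v] by (simp add: Av X_simps T_simps algebra_simps)
    finally show "v \<in> ?W" by (simp add: D_def)
  qed
  ultimately have "?W = UNIV" by (rule split_spaces_span)
  then have "D v = 0" by blast
  then show ?thesis by (simp add: D_def)
qed

lemma weight_map_surj:
  assumes X: "Vector_Spaces.linear s s X" "\<And>i v. i \<le> d \<Longrightarrow> v \<in> split_part i i \<Longrightarrow> X v = \<kappa> i *s v"
    and nz: "\<And>i. i \<le> d \<Longrightarrow> \<kappa> i \<noteq> 0"
  shows "surj X"
proof (rule split_spaces_span)
  show "subspace (range X)"
    by (rule endo.linear_subspace_image[OF X(1) subspace_UNIV])
  show "split_part i i \<subseteq> range X" if "i \<le> d" for i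
  proof
    fix v assume v: "v \<in> split_part i i"
    have "X (inverse (\<kappa> i) *s v) = v"
      using X(2)[OF that v] nz[OF that] by (simp add: endo.linear_scale[OF X(1)])
    then show "v \<in> range X" by (metis rangeI)
  qed
qed

end

section \<open>The algebra generated by the operators\<close>

text \<open>
  What the algebraic part of the argument uses: \<open>ai\<close>, \<open>qi\<close> and \<open>Ki\<close> are the inverses of \<open>a\<close>,
  \<open>q\<close> and \<open>K\<close>, and \<open>G\<close> stands for the union of the \<open>K\<^sub>i\<close>. With the inverses as separate
  variables, \<open>scalar_cancel\<close> and the exchange rules rewrite every expression to a normal form in
  which identities of operators can be read off.
\<close>

locale lowering_operators = vector_space s
  for s :: "'k::field \<Rightarrow> 'v::ab_group_add \<Rightarrow> 'v" (infixr "*s" 75) +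
  fixes A K Ki B \<psi> :: "'v \<Rightarrow> 'v" and a ai q qi :: 'k and G :: "'v set"
  assumes linear_A: "Vector_Spaces.linear s s A"
    and linear_K: "Vector_Spaces.linear s s K"
    and linear_Ki: "Vector_Spaces.linear s s Ki"
    and linear_B: "Vector_Spaces.linear s s B"
    and linear_psi: "Vector_Spaces.linear s s \<psi>"
    and K_Ki [simp]: "K (Ki v) = v" and Ki_K [simp]: "Ki (K v) = v"
    and a_ai: "a * ai = 1" and q_qi: "q * qi = 1"
    and K_A: "K (A v) = (qi * qi) *s A (K v) + (1 - qi * qi) *s (a *s K (K v) + ai *s v)"
    and B_A: "B (A v) = (qi * qi) *s A (B v) + (1 - qi * qi) *s (ai *s B (B v) + a *s v)"
    and psi_R: "\<psi> (A v - a *s K v - ai *s Ki v) - (A (\<psi> v) - a *s K (\<psi> v) - ai *s Ki (\<psi> v))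
      = (q - qi) *s (K v - Ki v)"
    and psi_G: "v \<in> G \<Longrightarrow> \<psi> v = 0"
    and G_eigen: "v \<in> G \<Longrightarrow> \<exists>\<kappa>. K v = \<kappa> *s v \<and> B v = \<kappa> *s v"
    and generated_A: "subspace W \<Longrightarrow> G \<subseteq> W \<Longrightarrow> (\<And>v. v \<in> W \<Longrightarrow> A v \<in> W) \<Longrightarrow> W = UNIV"
    and generated_R: "subspace W \<Longrightarrow> G \<subseteq> W
      \<Longrightarrow> (\<And>v. v \<in> W \<Longrightarrow> A v - a *s K v - ai *s Ki v \<in> W) \<Longrightarrow> W = UNIV"
begin

sublocale endo: vector_space_pair s s ..

lemmas linear_simps =
  endo.linear_add[OF linear_A] endo.linear_diff[OF linear_A] endo.linear_neg[OF linear_A]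
  endo.linear_scale[OF linear_A] endo.linear_0[OF linear_A]
  endo.linear_add[OF linear_K] endo.linear_diff[OF linear_K] endo.linear_neg[OF linear_K]
  endo.linear_scale[OF linear_K] endo.linear_0[OF linear_K]
  endo.linear_add[OF linear_Ki] endo.linear_diff[OF linear_Ki] endo.linear_neg[OF linear_Ki]
  endo.linear_scale[OF linear_Ki] endo.linear_0[OF linear_Ki]
  endo.linear_add[OF linear_B] endo.linear_diff[OF linear_B] endo.linear_neg[OF linear_B]
  endo.linear_scale[OF linear_B] endo.linear_0[OF linear_B]
  endo.linear_add[OF linear_psi] endo.linear_diff[OF linear_psi] endo.linear_neg[OF linear_psi]
  endo.linear_scale[OF linear_psi] endo.linear_0[OF linear_psi]

lemma scalar_cancel [simp]:
  "a * ai = 1" "q * qi = 1" "ai * a = 1" "qi * q = 1"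
  "a * (ai * x) = x" "q * (qi * x) = x" "ai * (a * x) = x" "qi * (q * x) = x"
  using a_ai q_qi by (simp_all add: mult.assoc[symmetric] mult.commute)

definition R :: "'v \<Rightarrow> 'v" where
  "R v = A v - a *s K v - ai *s Ki v"

lemma R_simps: "R (x + y) = R x + R y" "R (x - y) = R x - R y" "R (c *s x) = c *s R x" "R 0 = 0"
  by (simp_all add: R_def linear_simps algebra_simps)

lemma K_R: "K (R v) = (qi * qi) *s R (K v)"
  by (simp add: R_def linear_simps K_A algebra_simps)

lemma psi_R': "\<psi> (R v) = R (\<psi> v) + (q - qi) *s (K v - Ki v)"
  using psi_R[of v] unfolding R_def by (simp add: algebra_simps)

text \<open>
  The defect \<open>K \<psi> - q\<^sup>2 \<psi> K\<close> commutes with \<open>R\<close> up to a factor, since \<open>K R = q\<^sup>-\<^sup>2 R K\<close> and the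
  commutator of \<open>\<psi>\<close> and \<open>R\<close> is a Laurent polynomial in \<open>K\<close>; and it vanishes on \<open>G\<close>.
\<close>

lemma K_psi: "K (\<psi> v) = (q * q) *s \<psi> (K v)"
proof -
  let ?T = "\<lambda>v. K (\<psi> v) - (q * q) *s \<psi> (K v)"
  let ?W = "{v. ?T v = 0}"
  have T_R: "?T (R v) = (qi * qi) *s R (?T v)" for v
    by (simp add: K_R psi_R' linear_simps R_simps algebra_simps)
  have "?W = UNIV"
  proof (rule generated_R)
    show "subspace ?W"
      by (auto simp: subspace_def linear_simps algebra_simps)
    show "G \<subseteq> ?W"
      using psi_G G_eigen by (force simp: linear_simps)
    show "A v - a *s K v - ai *s Ki v \<in> ?W" if "v \<in> ?W" for v
      using T_R[of v] that by (simp add: R_def[symmetric] R_simps)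
  qed
  then show ?thesis by auto
qed

lemma Ki_psi: "Ki (\<psi> v) = (qi * qi) *s \<psi> (Ki v)"
proof -
  have "\<psi> v = K ((qi * qi) *s \<psi> (Ki v))"
    by (simp add: linear_simps K_psi mult.assoc)
  then show ?thesis by (metis Ki_K)
qed

lemma psi_A:
  "\<psi> (A v) = A (\<psi> v) + (a - a * (q * q)) *s \<psi> (K v) + (ai - ai * (qi * qi)) *s \<psi> (Ki v)
    + (q - qi) *s (K v - Ki v)"
  using psi_R[of v] by (simp add: linear_simps K_psi Ki_psi algebra_simps)

text \<open>
  In terms of the operators \<open>P\<close> and \<open>P'\<close> the equation \<open>q \<psi> (a K - a\<inverse> B) = K - B\<close> is
  \<open>P K = P' B\<close>; the operator \<open>S\<close> measures its failure.
\<close>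

definition P :: "'v \<Rightarrow> 'v" where "P v = (a * q) *s \<psi> v - v"
definition P' :: "'v \<Rightarrow> 'v" where "P' v = (ai * q) *s \<psi> v - v"
definition S :: "'v \<Rightarrow> 'v" where "S v = P (K v) - P' (B v)"

lemma S_simps: "S (x + y) = S x + S y" "S (x - y) = S x - S y" "S (c *s x) = c *s S x" "S 0 = 0"
  by (simp_all add: S_def P_def P'_def linear_simps algebra_simps)

text \<open>
  Moving \<open>A\<close> to the left through \<open>P K\<close> and \<open>P' B\<close> leaves terms in \<open>P K\<close>, \<open>P' B\<close>, \<open>K\<inverse> P K\<close> and
  \<open>K\<inverse> P' B\<close>, which pair up to multiples of \<open>S B\<close> and \<open>K\<inverse> S\<close>.
\<close>

lemma S_A: "S (A v) = (qi * qi) *s A (S v) + (ai - ai * (qi * qi)) *s (S (B v) + Ki (S v))"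
  by (simp add: S_def P_def P'_def linear_simps K_A B_A psi_A K_psi Ki_psi algebra_simps)

text \<open>
  Because of the term \<open>S (B v)\<close> in \<open>S_A\<close>, \<open>A\<close>-invariance of the kernel of \<open>S\<close> is not apparent. The
  rules \<open>S_A\<close> and \<open>B_A\<close> do show it for the largest \<open>B\<close>-invariant subspace of that kernel, which
  contains the common eigenvectors in \<open>G\<close>.
\<close>

lemma P_K_eq_P'_B: "P (K v) = P' (B v)"
proof -
  let ?N = "{v. \<forall>n. S ((B ^^ n) v) = 0}"
  have B_pow: "(B ^^ n) (x + y) = (B ^^ n) x + (B ^^ n) y" "(B ^^ n) (c *s x) = c *s (B ^^ n) x"
    "(B ^^ n) 0 = 0" for n c x y
    by (induction n) (simp_all add: linear_simps)
  have N: "subspace ?N"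
    by (auto simp: subspace_def B_pow S_simps)
  have B_N: "B x \<in> ?N" if "x \<in> ?N" for x
  proof -
    have "S ((B ^^ n) (B x)) = 0" for n
      using that spec[of "\<lambda>n. S ((B ^^ n) x) = 0" "Suc n"] by (simp add: funpow_swap1)
    then show ?thesis by blast
  qed
  have "?N = UNIV"
  proof (rule generated_A[OF N])
    show "G \<subseteq> ?N"
    proof
      fix v assume v: "v \<in> G"
      then obtain \<kappa> where \<kappa>: "K v = \<kappa> *s v" "B v = \<kappa> *s v" using G_eigen by blast
      have "S v = 0"
        using psi_G[OF v] by (simp add: S_def P_def P'_def \<kappa> linear_simps)
      moreover have "(B ^^ n) v = (\<kappa> ^ n) *s v" for n
        by (induction n) (simp_all add: linear_simps \<kappa> mult.commute)
      ultimately show "v \<in> ?N" by (simp add: S_simps)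
    qed
    have A_N: "S ((B ^^ n) (A x)) = 0" if "x \<in> ?N" for n x
      using that
    proof (induction n arbitrary: x)
      case 0
      then have "S x = 0" "S (B x) = 0" using B_N[of x] by (auto dest: spec[of _ 0])
      then show ?case by (simp add: S_A linear_simps)
    next
      case (Suc n)
      have "S ((B ^^ n) (A (B x))) = 0" using Suc.IH B_N Suc.prems by blast
      moreover have "S ((B ^^ n) (B (B x))) = 0" using B_N[OF B_N[OF Suc.prems]] by blast
      moreover have "S ((B ^^ n) x) = 0" using Suc.prems by blast
      moreover have "(B ^^ Suc n) (A x) = (B ^^ n) (B (A x))"
        by (simp add: funpow_swap1)
      ultimately show ?case by (simp add: B_A B_pow S_simps)
    qed
    then show "A v \<in> ?N" if "v \<in> ?N" for v using that by blast
  qed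
  then have "S ((B ^^ 0) v) = 0" by blast
  then show ?thesis by (simp add: S_def)
qed

definition C :: "'v \<Rightarrow> 'v" where "C v = a *s K v - ai *s B v"

lemma linear_C: "Vector_Spaces.linear s s C"
  unfolding C_def[abs_def]
  by (intro endo.linear_compose_sub endo.linear_compose_scale_right linear_K linear_B)

lemma psi_C: "q *s \<psi> (C v) = K v - B v"
  using P_K_eq_P'_B[of v] by (simp add: P_def P'_def C_def linear_simps algebra_simps)

text \<open>
  This factorization of \<open>(a\<inverse> - a) K\<close> makes \<open>C\<close> injective and \<open>P'\<close> surjective, so that in finite
  dimension both are invertible.
\<close>

lemma P'_C: "P' (C v) = (ai - a) *s K v"
proof -
  have "P' (C v) = ai *s (q *s \<psi> (C v)) - C v" by (simp add: P'_def)
  then show ?thesis unfolding psi_C by (simp add: C_def algebra_simps)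
qed

end

text \<open>
  Since numerator and denominator commute, one of the two one-sided quotients determines the
  other.
\<close>

lemma is_quotientI:
  assumes "Vector_Spaces.linear s s X" "Vector_Spaces.linear s s Y" "bij Y"
    and comm: "\<And>v. X (Y v) = Y (X v)" and Z: "\<And>v. Z (Y v) = X v"
  shows "is_quotient s Z X Y"
proof -
  have "Z v = X (inv Y v)" for v
    using Z[of "inv Y v"] bij_is_surj[OF \<open>bij Y\<close>] by (simp add: surj_f_inv_f)
  moreover have "inv Y (X v) = X (inv Y v)" for v
    using comm[of "inv Y v"] \<open>bij Y\<close>
    by (metis bij_inv_eq_iff)
  ultimately show ?thesis
    using assms by (auto simp: is_quotient_def)
qed

context lowering_operators
begin

context
  fixes Basis
  assumes fin: "finite_dimensional_vector_space s Basis" and a_neq: "a \<noteq> ai"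
begin

lemma inj_C: "inj C"
proof (rule injI)
  fix x y assume "C x = C y"
  then have "P' (C (x - y)) = 0" by (simp add: endo.linear_diff[OF linear_C] P'_def linear_simps)
  then have "K (x - y) = 0" using a_neq by (simp add: P'_C)
  then have "x - y = 0" by (metis Ki_K endo.linear_0[OF linear_Ki])
  then show "x = y" by simp
qed

lemma bij_C: "bij C"
  using finite_dimensional_vector_space.linear_inj_imp_surj[OF fin linear_C inj_C] inj_C
  by (simp add: bij_def)

lemma inj_P': "inj P'"
proof -
  have lin: "Vector_Spaces.linear s s P'"
    unfolding P'_def[abs_def]
    by (intro endo.linear_compose_sub endo.linear_compose_scale_right linear_psi linear_ident)
  have "P' (C (inverse (ai - a) *s Ki v)) = v" for v
    using a_neq by (simp add: P'_C linear_simps)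
  then have "surj P'" by (rule surjI)
  then show ?thesis
    by (rule finite_dimensional_vector_space.linear_surj_imp_inj[OF fin lin])
qed

text \<open>
  Moving \<open>\<psi>\<close> past \<open>K\<close> in \<open>P K = P' B\<close> gives this after composition with \<open>P'\<close>, which is
  injective.
\<close>

lemma B_psi: "B (\<psi> v) = (q * q) *s \<psi> (B v)"
proof -
  have "P' (B (\<psi> v)) = P (K (\<psi> v))" by (simp add: P_K_eq_P'_B)
  also have "\<dots> = (q * q) *s \<psi> (P (K v))"
    by (simp add: P_def K_psi linear_simps algebra_simps)
  also have "\<dots> = P' ((q * q) *s \<psi> (B v))"
    unfolding P_K_eq_P'_B by (simp add: P'_def linear_simps algebra_simps)
  finally show ?thesis by (rule injD[OF inj_P'])
qed

context
  fixes Bi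
  assumes linear_Bi: "Vector_Spaces.linear s s Bi"
    and B_Bi [simp]: "B (Bi v) = v" and Bi_B [simp]: "Bi (B v) = v"
begin

lemmas linear_Bi_simps =
  endo.linear_add[OF linear_Bi] endo.linear_diff[OF linear_Bi] endo.linear_neg[OF linear_Bi]
  endo.linear_scale[OF linear_Bi] endo.linear_0[OF linear_Bi]

lemma Bi_psi: "Bi (\<psi> v) = (qi * qi) *s \<psi> (Bi v)"
proof -
  have "\<psi> v = B ((qi * qi) *s \<psi> (Bi v))"
    by (simp add: linear_simps B_psi mult.assoc)
  then show ?thesis by (metis Bi_B)
qed

lemma bij_Ki: "bij Ki" by (rule bijI') (metis K_Ki, metis Ki_K)
lemma bij_Bi: "bij Bi" by (rule bijI') (metis B_Bi, metis Bi_B)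

lemma bij_scaled: "c \<noteq> 0 \<Longrightarrow> bij f \<Longrightarrow> bij (\<lambda>v. c *s f v)"
proof -
  assume c: "c \<noteq> 0" and f: "bij f"
  have "bij (\<lambda>v. c *s v)"
    by (rule o_bij[of "\<lambda>v. inverse c *s v"]) (use c in \<open>auto simp: fun_eq_iff\<close>)
  from bij_comp[OF f this] show ?thesis by (simp add: comp_def)
qed

lemma psi_C_eq: "\<psi> (C v) = qi *s (K v - B v)"
  using psi_C[of v, symmetric] by simp

lemma linear_intros:
  "Vector_Spaces.linear s s f \<Longrightarrow> Vector_Spaces.linear s s (\<lambda>v. K (f v))"
  "Vector_Spaces.linear s s f \<Longrightarrow> Vector_Spaces.linear s s (\<lambda>v. Ki (f v))"
  "Vector_Spaces.linear s s f \<Longrightarrow> Vector_Spaces.linear s s (\<lambda>v. B (f v))"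
  "Vector_Spaces.linear s s f \<Longrightarrow> Vector_Spaces.linear s s (\<lambda>v. Bi (f v))"
  using Vector_Spaces.linear_compose[of s s f s] linear_K linear_Ki linear_B linear_Bi
  by (auto simp: comp_def)

lemmas lin = endo.linear_compose_sub endo.linear_compose_scale_right linear_ident linear_intros

text \<open>
  The denominators are nonzero multiples of \<open>C K\<inverse>\<close>, \<open>C B\<inverse>\<close>, \<open>K\<inverse> C\<close> and \<open>B\<inverse> C\<close>. In the first two
  cases \<open>psi_C\<close> applies at once; in the other two \<open>\<psi>\<close> is first moved past \<open>K\<inverse>\<close> or \<open>B\<inverse>\<close>.
\<close>

lemma psi_quotients:
  "is_quotient s \<psi> (\<lambda>v. v - B (Ki v)) (\<lambda>v. q *s (a *s v - ai *s B (Ki v)))" (is ?q1)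
  "is_quotient s \<psi> (\<lambda>v. v - K (Bi v)) (\<lambda>v. q *s (ai *s v - a *s K (Bi v)))" (is ?q2)
  "is_quotient s \<psi> (\<lambda>v. q *s (v - Ki (B v))) (\<lambda>v. a *s v - ai *s Ki (B v))" (is ?q3)
  "is_quotient s \<psi> (\<lambda>v. q *s (v - Bi (K v))) (\<lambda>v. ai *s v - a *s Bi (K v))" (is ?q4)
proof -
  have q: "q \<noteq> 0" using q_qi by (metis mult_zero_left zero_neq_one)
  show ?q1
  proof (rule is_quotientI)
    have *: "q *s (a *s v - ai *s B (Ki v)) = q *s C (Ki v)" for v by (simp add: C_def)
    show "bij (\<lambda>v. q *s (a *s v - ai *s B (Ki v)))"
      unfolding * using bij_scaled[OF q bij_comp[OF bij_Ki bij_C]] by (simp add: comp_def)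
    show "\<psi> (q *s (a *s v - ai *s B (Ki v))) = v - B (Ki v)" for v
      unfolding * by (simp add: linear_simps psi_C_eq)
  qed (intro lin | simp add: linear_simps linear_Bi_simps algebra_simps)+
  show ?q2
  proof (rule is_quotientI)
    have *: "q *s (ai *s v - a *s K (Bi v)) = (-q) *s C (Bi v)" for v
      by (simp add: C_def algebra_simps)
    show "bij (\<lambda>v. q *s (ai *s v - a *s K (Bi v)))"
      unfolding * using bij_scaled[OF _ bij_comp[OF bij_Bi bij_C], of "-q"] q by (simp add: comp_def)
    show "\<psi> (q *s (ai *s v - a *s K (Bi v))) = v - K (Bi v)" for v
      unfolding * by (simp add: linear_simps psi_C_eq algebra_simps)
  qed (intro lin | simp add: linear_simps linear_Bi_simps algebra_simps)+
  show ?q3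
  proof (rule is_quotientI)
    have *: "a *s v - ai *s Ki (B v) = Ki (C v)" for v
      by (simp add: C_def linear_simps)
    show "bij (\<lambda>v. a *s v - ai *s Ki (B v))"
      unfolding * using bij_comp[OF bij_C bij_Ki] by (simp add: comp_def)
    have "\<psi> (Ki (C v)) = (q * q) *s Ki (\<psi> (C v))" for v
      by (simp add: Ki_psi mult.assoc)
    then show "\<psi> (a *s v - ai *s Ki (B v)) = q *s (v - Ki (B v))" for v
      unfolding * by (simp add: linear_simps psi_C_eq mult.assoc)
  qed (intro lin | simp add: linear_simps linear_Bi_simps algebra_simps)+
  show ?q4
  proof (rule is_quotientI)
    have *: "ai *s v - a *s Bi (K v) = (-1) *s Bi (C v)" for v
      by (simp add: C_def linear_Bi_simps)
    show "bij (\<lambda>v. ai *s v - a *s Bi (K v))"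
      unfolding * using bij_scaled[OF _ bij_comp[OF bij_C bij_Bi], of "-1"] by (simp add: comp_def)
    have "\<psi> (Bi (C v)) = (q * q) *s Bi (\<psi> (C v))" for v
      by (simp add: Bi_psi mult.assoc)
    then show "\<psi> (ai *s v - a *s Bi (K v)) = q *s (v - Bi (K v))" for v
      unfolding * by (simp add: linear_simps linear_Bi_simps psi_C_eq mult.assoc algebra_simps)
  qed (intro lin | simp add: linear_simps linear_Bi_simps algebra_simps)+
qed

end
end
end

section \<open>Tridiagonal systems of q-Racah type\<close>

text \<open>
  Since the eigenspaces span, every identity between the idempotents can be checked on the
  eigenspaces. There it holds because \<open>E i\<close> is the identity on its own eigenspace and kills the
  others.
\<close>

lemma spectral_resolution_of_standard_idempotents:
  fixes s :: "'k::field \<Rightarrow> 'v::ab_group_add \<Rightarrow> 'v"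
  assumes vs: "vector_space s" and diag: "diagonalizable s T"
    and std: "standard_idempotents s T T' d E"
    and eig: "\<And>i. i \<le> d \<Longrightarrow> range (E i) = eigenspace s T (\<theta> i)"
  shows "spectral_resolution s d T E \<theta>"
    and "\<And>i k v. i \<le> d \<Longrightarrow> k \<le> d \<Longrightarrow> i + 1 < k \<or> k + 1 < i \<Longrightarrow> E k (T' (E i v)) = 0"
proof -
  interpret vector_space s by fact
  interpret endo: vector_space_pair s s ..
  obtain V where ord: "standard_ordering s T T' d V"
    and prim: "\<And>i. i \<le> d \<Longrightarrow> primitive_idempotent s T (V i) (E i)"
    using std by (auto simp: standard_idempotents_def)
  have bij: "bij_betw V {0..d} (eigenspaces s T)"
    using ord by (auto simp: standard_ordering_def)
  have T: "Vector_Spaces.linear s s T" and span_UNIV: "span (\<Union>(eigenspaces s T)) = UNIV"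
    using diag by (auto simp: diagonalizable_def)
  note T_simps = endo.linear_add[OF T] endo.linear_scale[OF T] endo.linear_0[OF T]
  have lin: "Vector_Spaces.linear s s (E i)" if "i \<le> d" for i
    using prim[OF that] by (auto simp: primitive_idempotent_def)
  note E_simps = endo.linear_add[OF lin] endo.linear_scale[OF lin] endo.linear_0[OF lin]
  have V_mem: "V i \<in> eigenspaces s T" if "i \<le> d" for i
    using bij that by (auto simp: bij_betw_def)
  have V_neq: "V i \<noteq> V j" if "i \<le> d" "j \<le> d" "i \<noteq> j" for i j
    using bij that by (auto simp: bij_betw_def inj_on_def)
  have E_V: "E i v = (if i = j then v else 0)" if "i \<le> d" "j \<le> d" "v \<in> V j" for i j v
  proof (cases "i = j")
    case False
    have "v \<in> span (\<Union>(eigenspaces s T - {V i}))"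
      using V_mem[OF that(2)] V_neq[OF that(1,2) False] that(3) by (intro span_base) auto
    then show ?thesis using prim[OF that(1)] False by (auto simp: primitive_idempotent_def)
  qed (use prim[OF that(1)] that in \<open>auto simp: primitive_idempotent_def\<close>)
  have by_V: "x \<in> W" if W: "subspace W" "\<And>j v. j \<le> d \<Longrightarrow> v \<in> V j \<Longrightarrow> v \<in> W" for W x
  proof -
    have "eigenspaces s T = V ` {0..d}"
      using bij by (simp add: bij_betw_def)
    then have "\<Union>(eigenspaces s T) \<subseteq> W"
      using W(2) by auto
    then show ?thesis using span_minimal[OF _ W(1)] span_UNIV by blast
  qed
  have sub_V: "subspace (V i)" if "i \<le> d" for i
  proof -
    from V_mem[OF that] obtain c where "V i = eigenspace s T c"
      unfolding eigenspaces_def by blast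
    then show ?thesis
      by (simp add: eigenspace_def subspace_def T_simps scale_right_distrib mult.commute)
  qed
  have E_in_V: "E i x \<in> V i" if "i \<le> d" for i x
  proof -
    have "x \<in> {x. E i x \<in> V i}"
    proof (rule by_V)
      show "subspace {x. E i x \<in> V i}"
        using sub_V[OF that] that by (auto simp: subspace_def E_simps)
      show "v \<in> {x. E i x \<in> V i}" if "j \<le> d" "v \<in> V j" for j v
        using E_V[of i j v] \<open>i \<le> d\<close> that subspace_0[OF sub_V[OF \<open>i \<le> d\<close>]] by auto
    qed
    then show ?thesis by simp
  qed
  have V_range: "V i = range (E i)" if "i \<le> d" for i
  proof
    show "range (E i) \<subseteq> V i" using E_in_V[OF that] by blast
    show "V i \<subseteq> range (E i)"
    proof
      fix v assume "v \<in> V i"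
      then have "v = E i v" using E_V[OF that that] by simp
      then show "v \<in> range (E i)" by (rule range_eqI)
    qed
  qed
  have T_E: "T (E i v) = s (\<theta> i) (E i v)" if "i \<le> d" for i v
    using eig[OF that] by (auto simp: eigenspace_def)
  have E_E: "E i (E j v) = (if i = j then E i v else 0)" if "i \<le> d" "j \<le> d" for i j v
    using E_V[OF that E_in_V[OF that(2)]] by auto
  have sum_E: "(\<Sum>i\<le>d. E i v) = v" for v
  proof -
    have "v \<in> {v. (\<Sum>i\<le>d. E i v) = v}"
    proof (rule by_V)
      show "subspace {v. (\<Sum>i\<le>d. E i v) = v}"
        by (auto simp: subspace_def E_simps sum.distrib scale_sum_right[symmetric])
      show "v \<in> {v. (\<Sum>i\<le>d. E i v) = v}" if "j \<le> d" "v \<in> V j" for j v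
      proof -
        have "(\<Sum>i\<le>d. E i v) = (\<Sum>i\<le>d. if i = j then v else 0)"
          using E_V that by (intro sum.cong) auto
        then show ?thesis using that by simp
      qed
    qed
    then show ?thesis by simp
  qed
  have E_T: "E i (T v) = s (\<theta> i) (E i v)" if i: "i \<le> d" for i v
  proof -
    have "T v = (\<Sum>j\<le>d. s (\<theta> j) (E j v))"
      by (subst sum_E[of v, symmetric]) (simp add: endo.linear_sum[OF T] T_E)
    then have "E i (T v) = (\<Sum>j\<le>d. s (\<theta> j) (E i (E j v)))"
      using i by (simp add: endo.linear_sum[OF lin[OF i]] E_simps)
    also have "\<dots> = (\<Sum>j\<le>d. if j = i then s (\<theta> i) (E i v) else 0)"
      using i by (intro sum.cong) (auto simp: E_E)
    finally show ?thesis using i by simp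
  qed
  show "spectral_resolution s d T E \<theta>"
  proof (intro spectral_resolution.intro spectral_resolution_axioms.intro)
    show "inj_on \<theta> {..d}"
    proof (rule inj_onI)
      fix i j assume "i \<in> {..d}" "j \<in> {..d}" "\<theta> i = \<theta> j"
      then show "i = j" using eig[of i] eig[of j] V_range[of i] V_range[of j] V_neq[of i j] by auto
    qed
    show "\<exists>v. E i v \<noteq> 0" if "i \<le> d" for i
    proof -
      have "V i \<noteq> {0}" using V_mem[OF that] by (auto simp: eigenspaces_def)
      then show ?thesis using V_range[OF that] by (auto simp: image_iff)
    qed
  qed (fact vs T lin E_E sum_E E_T)+
  show "E k (T' (E i v)) = 0" if "i \<le> d" "k \<le> d" "i + 1 < k \<or> k + 1 < i" for i k v
  proof -
    have "T' (E i v) \<in> (if i = 0 then {0} else V (i - 1)) + V i + (if i = d then {0} else V (i + 1))"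
      using ord E_in_V[OF that(1), of v] that(1) unfolding standard_ordering_def by blast
    then obtain x y z where xyz: "T' (E i v) = x + y + z"
      "x \<in> (if i = 0 then {0} else V (i - 1))" "y \<in> V i" "z \<in> (if i = d then {0} else V (i + 1))"
      by (auto elim!: set_plus_elim)
    have "E k x = 0" using E_V[of k "i - 1" x] xyz(2) that by (auto simp: E_simps split: if_splits)
    moreover have "E k y = 0" using E_V[of k i y] xyz(3) that by auto
    moreover have "E k z = 0" using E_V[of k "i + 1" z] xyz(4) that by (auto simp: E_simps split: if_splits)
    ultimately show ?thesis using that by (simp add: xyz(1) E_simps)
  qed
qed

theorem theorem9p8:
  fixes s :: "'k::alg_closed_field \<Rightarrow> 'v::ab_group_add \<Rightarrow> 'v"
    and Basis :: "'v set"
    and d :: nat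
    and A As K B \<psi> :: "'v \<Rightarrow> 'v"
    and E Es :: "nat \<Rightarrow> 'v \<Rightarrow> 'v"
    and q a b :: 'k
  assumes "finite_dimensional_vector_space s Basis"
    and "(UNIV :: 'v set) \<noteq> {0}"
    and "d \<ge> 1"
    and "TD_system s d A E As Es"
    and "q_Racah_type s d A E As Es q a b"
    and "acts_by_weights s q d (split_space d E Es) K"
    and "acts_by_weights s q d (split_space_down d E Es) B"
    and "is_psi s d A E Es q a K \<psi>"
  shows
    "is_quotient s \<psi>
           (\<lambda>v. v - B (inv K v))
           (\<lambda>v. s q (s a v - s (inverse a) (B (inv K v)))) \<and>
     is_quotient s \<psi>
           (\<lambda>v. v - K (inv B v))
           (\<lambda>v. s q (s (inverse a) v - s a (K (inv B v)))) \<and>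
     is_quotient s \<psi>
           (\<lambda>v. s q (v - inv K (B v)))
           (\<lambda>v. s a v - s (inverse a) (inv K (B v))) \<and>
     is_quotient s \<psi>
           (\<lambda>v. s q (v - inv B (K v)))
           (\<lambda>v. s (inverse a) v - s a (inv B (K v)))"
proof -
  note fin = assms(1)
  interpret fd: finite_dimensional_vector_space s Basis by (rule fin)
  have vs: "vector_space s" ..
  interpret endo: vector_space_pair s s ..
  define \<kappa> :: "nat \<Rightarrow> 'k" where "\<kappa> i = q powi (int d - 2 * int i)" for i
  define \<theta> where "\<theta> i = a * \<kappa> i + inverse a * inverse (\<kappa> i)" for i
  define \<theta>s where "\<theta>s i = b * \<kappa> i + inverse b * inverse (\<kappa> i)" for i
  have q: "q \<noteq> 0" and a: "a \<noteq> 0" using assms(5) by (auto simp: q_Racah_type_def)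
  have \<kappa>_nz: "\<kappa> i \<noteq> 0" for i using q by (simp add: \<kappa>_def)
  have inverse_\<kappa>: "q powi (2 * int i - int d) = inverse (\<kappa> i)" for i
    by (simp add: \<kappa>_def power_int_minus[symmetric])
  have \<kappa>_Suc: "\<kappa> (Suc i) = inverse q * inverse q * \<kappa> i" for i
  proof -
    have "\<kappa> i = \<kappa> (Suc i) * q powi 2"
      using power_int_add[of q "int d - 2 * int (Suc i)" 2] q by (simp add: \<kappa>_def)
    then show ?thesis using q by (simp add: power2_eq_square field_simps)
  qed
  have \<kappa>_rev: "\<kappa> (d - i) = inverse (\<kappa> i)" if "i \<le> d" for i
    unfolding inverse_\<kappa>[symmetric] using that by (simp add: \<kappa>_def of_nat_diff algebra_simps)
  have TD: "diagonalizable s A" "diagonalizable s As"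
    "standard_idempotents s A As d E" "standard_idempotents s As A d Es"
    and irred: "\<And>W. module.subspace s W \<Longrightarrow> A ` W \<subseteq> W \<Longrightarrow> As ` W \<subseteq> W \<Longrightarrow> W = {0} \<or> W = UNIV"
    using assms(4) by (auto simp: TD_system_def TD_pair_def)
  have eig: "range (E i) = eigenspace s A (\<theta> i)" "range (Es i) = eigenspace s As (\<theta>s i)"
    if "i \<le> d" for i
    using assms(5) that by (auto simp: q_Racah_type_def \<theta>_def \<theta>s_def inverse_\<kappa> \<kappa>_def[symmetric])
  have res: "spectral_resolution s d A E \<theta>"
    by (rule spectral_resolution_of_standard_idempotents(1)[OF vs TD(1,3) eig(1)])
  have res_star: "spectral_resolution s d As Es \<theta>s"
    by (rule spectral_resolution_of_standard_idempotents(1)[OF vs TD(2,4) eig(2)])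
  interpret tridiagonal_system s d A As E Es \<theta> \<theta>s
  proof (intro tridiagonal_system.intro tridiagonal_system_axioms.intro)
    show "E k (As (E i v)) = 0" if "i \<le> d" "k \<le> d" "i + 1 < k \<or> k + 1 < i" for i k v
      by (rule spectral_resolution_of_standard_idempotents(2)[OF vs TD(1,3) eig(1) that])
    show "Es k (A (Es i v)) = 0" if "i \<le> d" "k \<le> d" "i + 1 < k \<or> k + 1 < i" for i k v
      by (rule spectral_resolution_of_standard_idempotents(2)[OF vs TD(2,4) eig(2) that])
  qed (fact res res_star irred)+
  interpret rev: tridiagonal_system s d A As "\<lambda>k. E (d - k)" Es "\<lambda>k. \<theta> (d - k)" \<theta>s
    by (rule tridiagonal_system_reversed)
  have flag: "(\<Sum>j=0..i. range (Es j)) = star.comps {..i}" if "i \<le> d" for i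
    using star.sum_of_ranges[of "{0..i}"] that by (simp add: atLeast0AtMost)
  have split_eq: "split_space d E Es i = split_part i i" if "i \<le> d" for i
  proof -
    have "(\<Sum>j=i..d. range (E j)) = comps {i..d}" by (rule sum_of_ranges) auto
    also have "\<dots> = comps {i..}" by (auto simp: comps_def)
    finally show ?thesis using flag[OF that] by (simp add: split_space_def split_part_def)
  qed
  have split_down_eq: "split_space_down d E Es i = rev.split_part i i" if "i \<le> d" for i
  proof -
    have "(\<Sum>j=0..d - i. range (E j)) = comps {0..d - i}" by (rule sum_of_ranges) auto
    also have "\<dots> = rev.comps {i..}"
    proof (intro set_eqI iffI)
      fix v assume v: "v \<in> comps {0..d - i}"
      have "E (d - k) v = 0" if "k \<le> d" "k < i" for k
        using v that \<open>i \<le> d\<close> by (auto simp: comps_def)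
      then show "v \<in> rev.comps {i..}" by (auto simp: rev.comps_def)
    next
      fix v assume v: "v \<in> rev.comps {i..}"
      have "E k v = 0" if "k \<le> d" "d - i < k" for k
      proof -
        have "d - k < i" using that \<open>i \<le> d\<close> by linarith
        then have "E (d - (d - k)) v = 0" using v by (simp add: rev.comps_def)
        then show ?thesis using that by simp
      qed
      then show "v \<in> comps {0..d - i}" by (auto simp: comps_def)
    qed
    finally show ?thesis using flag[OF that] by (simp add: split_space_down_def rev.split_part_def)
  qed
  have kernel_eq: "K_space d E Es i = kernel_part i" if "2 * i \<le> d" for i
  proof -
    have "(\<Sum>j=i..d - i. range (E j)) = comps {i..d - i}" by (rule sum_of_ranges) auto
    then show ?thesis using flag[of i] that by (simp add: K_space_def kernel_part_def)
  qed
  have K: "Vector_Spaces.linear s s K" "\<And>i v. i \<le> d \<Longrightarrow> v \<in> split_part i i \<Longrightarrow> K v = s (\<kappa> i) v"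
    using assms(6) by (auto simp: acts_by_weights_def split_eq \<kappa>_def)
  have B: "Vector_Spaces.linear s s B" "\<And>i v. i \<le> d \<Longrightarrow> v \<in> rev.split_part i i \<Longrightarrow> B v = s (\<kappa> i) v"
    using assms(7) by (auto simp: acts_by_weights_def split_down_eq \<kappa>_def)
  have "surj K" by (rule weight_map_surj[OF K \<kappa>_nz])
  then have "bij K" using fd.linear_surj_imp_inj[OF K(1)] by (simp add: bij_def)
  have "surj B" by (rule rev.weight_map_surj[OF B \<kappa>_nz])
  then have "bij B" using fd.linear_surj_imp_inj[OF B(1)] by (simp add: bij_def)
  have inv: "f (inv f v) = v" "inv f (f v) = v" if "bij f" for f :: "'v \<Rightarrow> 'v" and v
    using that by (simp_all add: bij_def surj_f_inv_f)
  have linear_inv: "Vector_Spaces.linear s s (inv f)"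
    if f: "bij f" "Vector_Spaces.linear s s f" for f
  proof -
    have "inv f (x + y) = inv f x + inv f y" for x y
      by (rule injD[OF bij_is_inj[OF f(1)]]) (simp add: inv f endo.linear_add[OF f(2)])
    moreover have "inv f (s c x) = s c (inv f x)" for c x
      by (rule injD[OF bij_is_inj[OF f(1)]]) (simp add: inv f endo.linear_scale[OF f(2)])
    ultimately show ?thesis using vs by (simp add: Vector_Spaces.linear_iff)
  qed
  have inv_K: "inv K v = s (inverse (\<kappa> i)) v" if "i \<le> d" "v \<in> split_part i i" for i v
  proof -
    have "K (s (inverse (\<kappa> i)) v) = v"
      using K(2)[OF that] \<kappa>_nz[of i] by (simp add: endo.linear_scale[OF K(1)])
    then show ?thesis using inv(2)[OF \<open>bij K\<close>] by metis
  qed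
  have psi: "Vector_Spaces.linear s s \<psi>"
    and psi_R: "\<And>v. \<psi> (A v - s a (K v) - s (inverse a) (inv K v))
        - (A (\<psi> v) - s a (K (\<psi> v)) - s (inverse a) (inv K (\<psi> v)))
      = s (q - inverse q) (K v - inv K v)"
    and psi_kernel: "\<And>i v. 2 * i \<le> d \<Longrightarrow> v \<in> kernel_part i \<Longrightarrow> \<psi> v = 0"
    using assms(8) by (auto simp: is_psi_def R_map_def kernel_eq)
  let ?G = "\<Union>i\<in>{i. 2 * i \<le> d}. kernel_part i"
  interpret lowering_operators s A K "inv K" B \<psi> a "inverse a" q "inverse q" ?G
  proof (intro lowering_operators.intro lowering_operators_axioms.intro)
    show "K (A v) = s (inverse q * inverse q) (A (K v))
        + s (1 - inverse q * inverse q) (s a (K (K v)) + s (inverse a) v)" for v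
      by (rule weight_map_A[where \<kappa> = \<kappa>, OF K _ \<kappa>_Suc]) (use \<kappa>_nz in \<open>simp_all add: \<theta>_def algebra_simps\<close>)
    \<comment> \<open>By \<open>\<kappa>_rev\<close>, inverting the order of the eigenspaces exchanges \<open>a\<close> and \<open>a\<inverse>\<close>.\<close>
    show "B (A v) = s (inverse q * inverse q) (A (B v))
        + s (1 - inverse q * inverse q) (s (inverse a) (B (B v)) + s a v)" for v
      by (rule rev.weight_map_A[where \<kappa> = \<kappa>, OF B _ \<kappa>_Suc])
        (use \<kappa>_nz in \<open>simp_all add: \<theta>_def \<kappa>_rev algebra_simps\<close>)
    show "\<exists>\<kappa>. K v = s \<kappa> v \<and> B v = s \<kappa> v" if v: "v \<in> ?G" for v
    proof -
      obtain i where i: "2 * i \<le> d" "v \<in> kernel_part i" using v by blast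
      have "E (d - k) v = 0" if "k < i" for k
      proof -
        have "d - k \<notin> {i..d - i}" using that i(1) by auto
        then show ?thesis using i(2) by (simp add: kernel_part_def comps_def)
      qed
      then have "v \<in> split_part i i" "v \<in> rev.split_part i i"
        using i by (auto simp: kernel_part_def split_part_def rev.split_part_def comps_def rev.comps_def)
      then show ?thesis using K(2)[of i v] B(2)[of i v] i(1) by auto
    qed
    show "W = UNIV" if W: "fd.subspace W" "?G \<subseteq> W" "\<And>v. v \<in> W \<Longrightarrow> A v \<in> W" for W
    proof (rule generated_by_kernel_parts[OF W(1)])
      show "A v - s (\<theta> i) v \<in> W" if "v \<in> W" for i v
        using W that by (intro fd.subspace_diff fd.subspace_scale)
    qed (use W(2) in blast)
    show "W = UNIV" if W: "fd.subspace W" "?G \<subseteq> W"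
      "\<And>v. v \<in> W \<Longrightarrow> A v - s a (K v) - s (inverse a) (inv K v) \<in> W" for W
    proof (rule generated_by_kernel_parts[OF W(1)])
      show "A v - s (\<theta> i) v \<in> W" if "i \<le> d" "v \<in> W" "v \<in> split_part i i" for i v
      proof -
        \<comment> \<open>\<open>R\<close> and \<open>A - \<theta>\<^sub>i\<close> agree on the \<open>i\<close>-th summand.\<close>
        have "A v - s (\<theta> i) v = A v - s a (K v) - s (inverse a) (inv K v)"
          using K(2)[OF that(1,3)] inv_K[OF that(1,3)]
          by (simp add: \<theta>_def fd.scale_left_distrib)
        then show ?thesis using W(3)[OF that(2)] by metis
      qed
    qed (use W(2) in blast)
    show "\<psi> v = 0" if "v \<in> ?G" for v using psi_kernel that by blast
    show "\<psi> (A v - s a (K v) - s (inverse a) (inv K v))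
        - (A (\<psi> v) - s a (K (\<psi> v)) - s (inverse a) (inv K (\<psi> v)))
      = s (q - inverse q) (K v - inv K v)" for v by (rule psi_R)
    show "a * inverse a = 1" "q * inverse q = 1" using a q by simp_all
  qed (simp_all add: vs linear_T K(1) B(1) psi linear_inv inv \<open>bij K\<close>)
  \<comment> \<open>If \<open>a = a\<inverse>\<close>, inverting the order of the eigenvalues changes nothing, but \<open>\<theta>\<^sub>0 \<noteq> \<theta>\<^sub>d\<close>.\<close>
  have "a \<noteq> inverse a"
  proof
    assume "a = inverse a"
    then have "\<theta> 0 = \<theta> d"
      using \<kappa>_rev[of 0] by (simp add: \<theta>_def)
    then show False using theta_neq[of 0 d] assms(3) by simp
  qed
  show ?thesis
    using psi_quotients[OF fin \<open>a \<noteq> inverse a\<close> linear_inv[OF \<open>bij B\<close> B(1)]] inv[OF \<open>bij B\<close>] by blast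
qed

end
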